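(* Let $n\ge 2$ and let $(\mathbf{d},\mathbf{r})$ be an arithmetical structure on the cycle $\mathcal{C}_n$. Then \[\mathbf{r}(1)=3n-\sum_{j=1}^n d_j\] and the critical group satisfies $K(\mathcal{C}_n,\mathbf{d},\mathbf{r})\cong\mathbb{Z}/\mathbf{r}(1)\mathbb{Z}$.
   Context: For $n\ge 3$, $\mathcal{C}_n$ is the cycle graph with vertices $1,\dots,n$ and edges $\{i,i+1\}$ (indices mod $n$); $\mathcal{C}_2$ is two vertices joined by two parallel edges (adjacency matrix $\begin{pmatrix}0&2\\2&0\end{pmatrix}$). An arithmetical structure on $\mathcal{C}_n$ is a pair $(\mathbf{d},\mathbf{r})$ of positive integer vectors in $\mathbb{Z}^n$ with $\mathbf{r}$ primitive (gcd of entries $1$) and $(\operatorname{diag}(\mathbf{d})-A)\mathbf{r}=\mathbf{0}$, $A$ the adjacency matrix. The critical group $K(\mathcal{C}_n,\mathbf{d},\mathbf{r})$ is the torsion subgroup of $\mathbb{Z}^n/\operatorname{im}(\operatorname{diag}(\mathbf{d})-A)$. $\mathbf{r}(1)=\#\{i:r_i=1\}$. *)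

theory Defs
  imports
    "Jordan_Normal_Form.Matrix"
    "HOL-Algebra.Elementary_Groups"
begin

(* The multigraph C_n has vertices 0, ..., n-1 (instead of 1, ..., n) and, for each k < n, one
   edge joining k and k + 1 mod n.  Entries of the adjacency matrix count parallel edges, so
   that C_2 has a double edge. *)
definition cycle_adj_mat :: "nat \<Rightarrow> int mat" where
  "cycle_adj_mat n =
     Matrix.mat n n (\<lambda>(i, j). int (card {k. k < n \<and> {k, Suc k mod n} = {i, j}}))"

lemma cycle_adj_mat_2: "cycle_adj_mat 2 = mat_of_rows_list 2 [[0, 2], [2, 0]]"
proof -
  have *: "{k. k < 2 \<and> {k, Suc k mod 2} = {i, j}} = (if i = j then {} else {0, 1})"
    if "i < 2" "j < 2" for i j :: nat
    using that by (auto simp: less_2_cases_iff doubleton_eq_iff)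
  have "cycle_adj_mat 2 = Matrix.mat 2 2 (\<lambda>(i, j). if i = j then 0 else 2)"
    unfolding cycle_adj_mat_def by (rule cong_mat) (simp_all add: *)
  also have "\<dots> = mat_of_rows_list 2 [[0, 2], [2, 0]]"
    unfolding mat_of_rows_list_def by (rule cong_mat) (auto dest!: less_2_cases)
  finally show ?thesis .
qed

lemma cycle_adj_mat_ge3:
  assumes "n \<ge> 3"
  shows "cycle_adj_mat n =
    Matrix.mat n n (\<lambda>(i, j). if j = Suc i mod n \<or> i = Suc j mod n then 1 else 0)"
proof (rule eq_matI)
  fix i j
  assume "i < dim_row (Matrix.mat n n
      (\<lambda>(i, j). if j = Suc i mod n \<or> i = Suc j mod n then 1 else 0 :: int))"
    and "j < dim_col (Matrix.mat n n
      (\<lambda>(i, j). if j = Suc i mod n \<or> i = Suc j mod n then 1 else 0 :: int))"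
  then have ij: "i < n" "j < n"
    by auto
  have not_both: "\<not> (j = Suc i mod n \<and> i = Suc j mod n)"
    using assms ij by (auto simp: mod_Suc split: if_splits)
  have "{k. k < n \<and> {k, Suc k mod n} = {i, j}} =
      (if j = Suc i mod n then {i} else if i = Suc j mod n then {j} else {})"
    using ij not_both by (auto simp: doubleton_eq_iff)
  then show "cycle_adj_mat n $$ (i, j) = Matrix.mat n n
      (\<lambda>(i, j). if j = Suc i mod n \<or> i = Suc j mod n then 1 else 0) $$ (i, j)"
    using ij by (simp add: cycle_adj_mat_def)
qed (simp_all add: cycle_adj_mat_def)

definition arith_laplacian :: "int mat \<Rightarrow> int vec \<Rightarrow> int mat" where
  "arith_laplacian A d = mat_diag (dim_vec d) (\<lambda>i. d $ i) - A"

definition arithmetical_structure :: "nat \<Rightarrow> int mat \<Rightarrow> int vec \<Rightarrow> int vec \<Rightarrow> bool" where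
  "arithmetical_structure n A d r \<longleftrightarrow>
     d \<in> carrier_vec n \<and> r \<in> carrier_vec n \<and>
     (\<forall>i<n. d $ i > 0) \<and> (\<forall>i<n. r $ i > 0) \<and>
     (GCD i\<in>{..<n}. r $ i) = 1 \<and>
     arith_laplacian A d *\<^sub>v r = 0\<^sub>v n"

definition torsion_subgroup :: "('a, 'b) monoid_scheme \<Rightarrow> 'a set" where
  "torsion_subgroup G = {x \<in> carrier G. \<exists>m::nat. m > 0 \<and> x [^]\<^bsub>G\<^esub> m = \<one>\<^bsub>G\<^esub>}"

definition mat_cokernel :: "nat \<Rightarrow> int mat \<Rightarrow> int vec set monoid" where
  "mat_cokernel n M = monoid_vec TYPE(int) n Mod ((\<lambda>v. M *\<^sub>v v) ` carrier_vec n)"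

(* K(C_n, d, r) does not involve r, so r is not an argument; the torsion elements carry the
   group structure inherited from the cokernel. *)
definition critical_group :: "nat \<Rightarrow> int mat \<Rightarrow> int vec \<Rightarrow> int vec set monoid" where
  "critical_group n A d =
     (let Q = mat_cokernel n (arith_laplacian A d) in Q\<lparr>carrier := torsion_subgroup Q\<rparr>)"

definition num_ones :: "int vec \<Rightarrow> nat" where
  "num_ones r = card {i. i < dim_vec r \<and> r $ i = 1}"

end

theory Submission
  imports Defs
begin

text \<open>
  Read cyclically, the null vector satisfies $r_{j-1} + r_{j+1} = d_j r_j$ with consecutive entries
  coprime. Let $F(a, b)$ be the signed number of subtraction steps that reduce $(a, b)$ to $(1, 1)$
  in Euclid's algorithm. Then $F(r_j, r_{j+1}) - F(r_{j-1}, r_j) = 3 - d_j - [r_j = 1]$,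
  and summing over the cycle gives the formula for the number of ones.

  For the critical group, take a second solution $s$ of the recurrence with
  $r_j s_{j+1} - r_{j+1} s_j = 1$. It satisfies $s_{j+n} = s_j + k r_j$ for a constant $k$. The
  fractions $s_j / r_j$ form an increasing path of Farey neighbours, which cannot jump over an
  integer and advances by $k$ per period, so $k$ is the number of ones. By variation of constants,
  a vector $v$ lies in the image of the Laplacian iff $r \cdot v = 0$ and $k$ divides
  $s \cdot v$, so $v \mapsto s \cdot v$ identifies the torsion subgroup with the
  integers modulo $k$.
\<close>

section \<open>Euclid's algorithm and the local identity\<close>

text \<open>This is \<open>F\<close> of the introduction: for coprime positive arguments the exit
  \<open>a = b\<close> is the pair (1, 1). The exit on nonpositive arguments makes the recursion
  terminate everywhere.\<close>

function euclid_balance :: "int \<Rightarrow> int \<Rightarrow> int" where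
  "euclid_balance a b =
     (if a \<le> 0 \<or> b \<le> 0 \<or> a = b then 0
      else if a < b then euclid_balance a (b - a) - 1
      else euclid_balance (a - b) b + 1)"
  by auto
termination by (relation "measure (\<lambda>(a, b). nat (a + b))") auto

declare euclid_balance.simps [simp del]

lemma euclid_balance_add_left:
  assumes "a > 0" "b > 0"
  shows "euclid_balance (a + b) b = euclid_balance a b + 1"
  using assms by (subst euclid_balance.simps) simp

lemma euclid_balance_add_right:
  assumes "a > 0" "b > 0"
  shows "euclid_balance a (a + b) = euclid_balance a b - 1"
  using assms by (subst euclid_balance.simps) simp

lemma euclid_balance_self: "euclid_balance a a = 0"
  by (subst euclid_balance.simps) simp

text \<open>Replacing \<open>a\<close> by \<open>a + b\<close>, or \<open>c\<close> by \<open>c + b\<close>, raises \<open>d\<close> by one and preserves the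
  identity, which reduces it to \<open>a, c \<le> b\<close>.\<close>
lemma euclid_balance_step:
  assumes "a > 0" "b > 0" "c > 0" "coprime a b" "a + c = d * b"
  shows "euclid_balance b c = euclid_balance a b + 3 - d - of_bool (b = 1)"
  using assms
proof (induction "nat (a + c)" arbitrary: a c d rule: less_induct)
  case less
  have "coprime c b"
  proof (rule coprimeI)
    fix e assume "e dvd c" "e dvd b"
    moreover have "a = d * b - c" using less.prems by simp
    ultimately have "e dvd a" by simp
    then show "is_unit e" using \<open>e dvd b\<close> less.prems(4) coprime_common_divisor by blast
  qed
  consider "a > b" | "c > b" | "a \<le> b" "c \<le> b" by linarith
  then show ?case
  proof cases
    case 1
    have "coprime (a - b) b"
      using less.prems(4) by (metis coprime_iff_gcd_eq_1 gcd_diff1)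
    then have "euclid_balance b c = euclid_balance (a - b) b + 3 - (d - 1) - of_bool (b = 1)"
      using less.prems 1 by (intro less.hyps) (auto simp: algebra_simps)
    then show ?thesis
      using euclid_balance_add_left[of "a - b" b] 1 less.prems by simp
  next
    case 2
    then have "euclid_balance b (c - b) = euclid_balance a b + 3 - (d - 1) - of_bool (b = 1)"
      using less.prems by (intro less.hyps) (auto simp: algebra_simps)
    then show ?thesis
      using euclid_balance_add_right[of b "c - b"] 2 less.prems by simp
  next
    case 3
    show ?thesis
    proof (cases "b = 1")
      case True
      then have "a = 1" "c = 1" using 3 less.prems by linarith+
      then show ?thesis using True less.prems(5) by (simp add: euclid_balance_self)
    next
      case False
      \<comment> \<open>Coprimality with \<open>b > 1\<close> makes both neighbours smaller than
        \<open>b\<close>, so \<open>d = 1\<close> and \<open>b = a + c\<close>; one subtraction on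
        either side then leads to the pair \<open>(a, c)\<close>.\<close>
      have "a \<noteq> b" "c \<noteq> b" using less.prems \<open>coprime c b\<close> False by auto
      then have "a < b" "c < b" using 3 by auto
      then have "0 < d * b" "d * b < 2 * b" using less.prems by linarith+
      then have "0 < d" "d < 2"
        using less.prems(2) zero_less_mult_pos2[of d b] mult_right_less_imp_less[of d b 2]
        by linarith+
      then have "d = 1" by simp
      then have b: "b = a + c" using less.prems by simp
      have "euclid_balance b c = euclid_balance a c + 1"
        unfolding b using less.prems by (intro euclid_balance_add_left)
      moreover have "euclid_balance a b = euclid_balance a c - 1"
        unfolding b using less.prems by (intro euclid_balance_add_right)
      ultimately show ?thesis using \<open>d = 1\<close> False by simp
    qed
  qed
qed

section \<open>Periodic recurrences and the number of ones\<close>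

text \<open>The cycle is unrolled to sequences on all naturals, which also accommodate solutions of
  the recurrence that are not periodic.\<close>

locale cyclic_recurrence =
  fixes n :: nat and D R :: "nat \<Rightarrow> int"
  assumes n_ge_2: "n \<ge> 2"
    and D_periodic: "D (j + n) = D j"
    and R_periodic: "R (j + n) = R j"
    and R_pos: "R j > 0"
    and R_coprime: "coprime (R j) (R (Suc j))"
    and R_rec: "R j + R (Suc (Suc j)) = D (Suc j) * R (Suc j)"
begin

definition ones :: nat where
  "ones = card {i. i < n \<and> R i = 1}"

lemma sum_ones: "(\<Sum>i<n. of_bool (R i = 1)) = int ones"
proof -
  have "(\<Sum>i<n. of_bool (R i = 1)) = (\<Sum>i\<in>{i. i < n \<and> R i = 1}. 1 :: int)"
    by (intro sum.mono_neutral_cong_right) auto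
  then show ?thesis by (simp add: ones_def)
qed

lemma sum_shift:
  assumes "\<And>j. f (j + n) = f j"
  shows "(\<Sum>j<n. f (Suc j)) = (\<Sum>j<n. f j :: int)"
  using assms[of 0] sum.lessThan_Suc_shift[of f n] sum.lessThan_Suc[of f n] by simp

theorem ones_eq: "int ones = 3 * int n - (\<Sum>j<n. D j)"
proof -
  define F where "F j = euclid_balance (R j) (R (Suc j))" for j
  have "F (Suc j) - F j = 3 - D (Suc j) - of_bool (R (Suc j) = 1)" for j
    using euclid_balance_step[OF R_pos[of j] R_pos R_pos R_coprime R_rec] by (simp add: F_def)
  then have "(\<Sum>j<n. F (Suc j) - F j) = (\<Sum>j<n. 3 - D (Suc j) - of_bool (R (Suc j) = 1))"
    by simp
  moreover have "(\<Sum>j<n. F (Suc j) - F j) = 0"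
    using R_periodic[of 0] R_periodic[of 1]
    by (simp only: sum_lessThan_telescope) (simp add: F_def)
  ultimately show ?thesis
    using sum_shift[of D] sum_shift[of "\<lambda>j. of_bool (R j = 1)"] D_periodic R_periodic sum_ones
    by (simp add: sum_subtractf)
qed

end

section \<open>The second solution as a path of Farey neighbours\<close>

fun linrec :: "(nat \<Rightarrow> int) \<Rightarrow> int \<Rightarrow> int \<Rightarrow> nat \<Rightarrow> int" where
  "linrec D a b 0 = a"
| "linrec D a b (Suc 0) = b"
| "linrec D a b (Suc (Suc j)) = D (Suc j) * linrec D a b (Suc j) - linrec D a b j"

text \<open>The quotient \<open>(s - 1) div r\<close> is one less than the ceiling of \<open>s / r\<close>.\<close>
lemma farey_step_div:
  fixes r r' s s' :: int
  assumes pos: "r > 0" "r' > 0" and det: "r * s' - r' * s = 1"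
  shows "(s' - 1) div r' = (s - 1) div r + of_bool (r = 1)"
proof -
  define q where "q = (s - 1) div r"
  have "q * r + (s - 1) mod r = s - 1"
    unfolding q_def by (rule div_mult_mod_eq)
  moreover have "0 \<le> (s - 1) mod r" "(s - 1) mod r < r"
    using pos by simp_all
  ultimately have q: "q * r < s" "s \<le> (q + 1) * r"
    unfolding distrib_right by linarith+
  show ?thesis
  proof (cases "s = (q + 1) * r")
    \<comment> \<open>Here \<open>s / r\<close> is an integer: the determinant forces
      \<open>r = 1\<close>, and \<open>s' / r'\<close> exceeds that integer by
      \<open>1 / r'\<close>, so the ceiling rises by one.\<close>
    case True
    then have "r * (s' - r' * (q + 1)) = 1" using det by (simp add: algebra_simps)
    then have "r = 1" using pos by (simp add: zmult_eq_1_iff)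
    then have "s' - 1 = (q + 1) * r'" using det True by (simp add: algebra_simps)
    then show ?thesis using pos \<open>r = 1\<close> by (simp add: q_def)
  next
    case False
    \<comment> \<open>The gap from \<open>s / r\<close> up to \<open>q + 1\<close> is at least
      \<open>1 / r\<close>, while the fraction advances by only \<open>1 / (r * r')\<close>, so it
      cannot pass \<open>q + 1\<close>.\<close>
    then have s: "s \<le> (q + 1) * r - 1" using q by simp
    have "r \<noteq> 1" using q s by auto
    have "r' * (q * r) < r' * s" using q pos by simp
    then have "r * (q * r') < r * s'" using det by (simp add: algebra_simps)
    then have 1: "q * r' < s'" using pos by simp
    have "r' * s \<le> r' * ((q + 1) * r - 1)" using s pos by simp
    then have "r * s' \<le> r * ((q + 1) * r')" using det pos by (simp add: algebra_simps)
    then have 2: "s' \<le> (q + 1) * r'" using pos by simp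
    have "(s' - 1) div r' = q"
      using 1 2 pos by (intro int_div_pos_eq[where r = "s' - 1 - q * r'"]) (auto simp: algebra_simps)
    then show ?thesis using \<open>r \<noteq> 1\<close> by (simp add: q_def)
  qed
qed

context cyclic_recurrence
begin

text \<open>The determinant is a Casoratian (discrete Wronskian). Shifting \<open>S\<close> by a
  period keeps it, so the shift changes \<open>S\<close> by a multiple of \<open>R\<close>, an
  integral one by coprimality.\<close>

lemma second_solution:
  obtains S where "\<And>j. S j + S (Suc (Suc j)) = D (Suc j) * S (Suc j)"
    and "\<And>j. R j * S (Suc j) - R (Suc j) * S j = 1"
    and "\<And>j. S (j + n) = S j + int ones * R j"
    and "ones > 0"
proof -
  \<comment> \<open>Bezout coefficients supply initial values of determinant 1.\<close>
  obtain a b where "a * R 0 + b * R (Suc 0) = 1"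
    using R_coprime[of 0] by (metis bezout_int coprime_iff_gcd_eq_1)
  define S where "S = linrec D (- b) a"
  have rec: "S j + S (Suc (Suc j)) = D (Suc j) * S (Suc j)" for j
    by (simp add: S_def)
  have det: "R j * S (Suc j) - R (Suc j) * S j = 1" for j
  proof (induction j)
    case 0
    show ?case using \<open>a * R 0 + b * R (Suc 0) = 1\<close> by (simp add: S_def algebra_simps)
  next
    case (Suc j)
    have *: "S (Suc (Suc j)) = D (Suc j) * S (Suc j) - S j"
      "R (Suc (Suc j)) = D (Suc j) * R (Suc j) - R j"
      using rec[of j] R_rec[of j] by simp_all
    show ?case unfolding * using Suc by (simp add: algebra_simps)
  qed
  have ex: "\<exists>k. S (j + n) - S j = k * R j" for j
  proof -
    have "R j * (S (Suc j + n) - S (Suc j)) = R (Suc j) * (S (j + n) - S j)"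
      using det[of j] det[of "j + n"] R_periodic[of j] R_periodic[of "Suc j"]
      by (simp add: algebra_simps)
    then have "R j dvd R (Suc j) * (S (j + n) - S j)" by (metis dvd_triv_left)
    then have "R j dvd S (j + n) - S j"
      using R_coprime by (simp add: coprime_dvd_mult_right_iff)
    then show ?thesis by (auto simp: mult.commute)
  qed
  then obtain K where K: "\<And>j. S (j + n) - S j = K j * R j" by metis
  have "K (Suc j) = K j" for j
  proof -
    have "R j * (S (Suc j + n) - S (Suc j)) = R (Suc j) * (S (j + n) - S j)"
      using det[of j] det[of "j + n"] R_periodic[of j] R_periodic[of "Suc j"]
      by (simp add: algebra_simps)
    then have "(R j * R (Suc j)) * K (Suc j) = (R j * R (Suc j)) * K j"
      unfolding K by (simp add: algebra_simps)
    then show ?thesis using R_pos[of j] R_pos[of "Suc j"] by simp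
  qed
  then have K_const: "K j = K 0" for j by (induction j) auto
  have per: "S (j + n) = S j + K 0 * R j" for j
    using K[of j] K_const[of j] by simp
  \<comment> \<open>\<open>C j\<close> is one less than the ceiling of \<open>S j / R j\<close>. Its
    increase over a period is both the number of integers passed, \<open>ones\<close>, and the shift
    \<open>K 0\<close>.\<close>
  define C where "C j = (S j - 1) div R j" for j
  have "C (Suc j) - C j = of_bool (R j = 1)" for j
    using farey_step_div[OF R_pos R_pos det] by (simp add: C_def)
  then have "(\<Sum>j<n. C (Suc j) - C j) = int ones"
    by (simp add: sum_ones)
  moreover have "C n - C 0 = K 0"
  proof -
    have "S n - 1 = (S 0 - 1) + K 0 * R 0" "R n = R 0"
      using per[of 0] R_periodic[of 0] by simp_all
    then have "C n = ((S 0 - 1) + K 0 * R 0) div R 0"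
      by (simp only: C_def)
    also have "\<dots> = K 0 + C 0"
      using R_pos[of 0] by (simp only: C_def div_mult_self1)
    finally show ?thesis by simp
  qed
  ultimately have K0: "K 0 = int ones"
    by (simp only: sum_lessThan_telescope)
  \<comment> \<open>Positivity of \<open>ones\<close>: the fractions strictly increase, so the shift
    over a period is not zero.\<close>
  have less: "real_of_int (S j) / R j < S (Suc j) / R (Suc j)" for j
  proof -
    have "S j * R (Suc j) < S (Suc j) * R j"
      using det[of j] by (simp add: mult.commute)
    then have "real_of_int (S j) * R (Suc j) < S (Suc j) * R j"
      by (metis of_int_less_iff of_int_mult)
    then show ?thesis using R_pos[of j] R_pos[of "Suc j"] by (simp add: field_simps)
  qed
  have "real_of_int (S 0) / R 0 < S n / R n"
    by (rule lift_Suc_mono_less[of "\<lambda>j. real_of_int (S j) / R j", OF less])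
      (use n_ge_2 in simp)
  then have "S 0 \<noteq> S n" using R_periodic[of 0] by auto
  then have "ones > 0" using per[of 0] K0 by auto
  then show thesis using that[OF rec det per[unfolded K0]] by simp
qed

end

section \<open>Torsion in a quotient group\<close>

text \<open>\<open>T\<close> is the preimage of the torsion subgroup under the quotient map, so the
  torsion subgroup is \<open>T\<close> modulo \<open>I\<close>, and the first isomorphism theorem
  applies to \<open>h\<close>.\<close>

lemma (in comm_group) torsion_of_quotient_iso:
  assumes "subgroup T G" and "group H"
    and hom: "h \<in> hom (G\<lparr>carrier := T\<rparr>) H" and surj: "h ` T = carrier H"
    and I: "I = kernel (G\<lparr>carrier := T\<rparr>) H h"
    and torsion: "\<And>a. a \<in> carrier G \<Longrightarrow> (\<exists>m::nat>0. a [^] m \<in> I) \<longleftrightarrow> a \<in> T"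
  shows "(G Mod I)\<lparr>carrier := torsion_subgroup (G Mod I)\<rparr> \<cong> H"
proof -
  interpret T: group "G\<lparr>carrier := T\<rparr>"
    using assms(1) by (rule subgroup_imp_group)
  interpret h: group_hom "G\<lparr>carrier := T\<rparr>" H h
    using \<open>group H\<close> hom by (simp add: group_hom_def group_hom_axioms_def)
  have "subgroup I (G\<lparr>carrier := T\<rparr>)"
    unfolding I by (rule h.subgroup_kernel)
  then have I_sub: "subgroup I G"
    using assms(1) incl_subgroup by blast
  then interpret I: normal I G
    by (rule subgroup_imp_normal)
  have coset_eq_I: "I #> a = I \<longleftrightarrow> a \<in> I" if "a \<in> carrier G" for a
    using that I_sub coset_join1 coset_join2 by metis
  have "torsion_subgroup (G Mod I) = (\<lambda>a. I #> a) ` T"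
  proof -
    have "(\<exists>m::nat>0. (I #> a) [^]\<^bsub>G Mod I\<^esub> m = I) \<longleftrightarrow> a \<in> T" if "a \<in> carrier G" for a
      using that torsion[OF that] by (simp add: I.FactGroup_pow coset_eq_I)
    then show ?thesis
      using subgroup.subset[OF assms(1)]
      unfolding torsion_subgroup_def carrier_FactGroup one_FactGroup by blast
  qed
  \<comment> \<open>Cosets of \<open>I\<close> by elements of \<open>T\<close> are the same sets in
    \<open>G\<close> and in \<open>T\<close>, so this is an equality of structures.\<close>
  then have "(G Mod I)\<lparr>carrier := torsion_subgroup (G Mod I)\<rparr> = G\<lparr>carrier := T\<rparr> Mod I"
    by (auto simp: FactGroup_def RCOSETS_def r_coset_def set_mult_def fun_eq_iff)
  also have "\<dots> \<cong> H"
    unfolding I using surj by (intro h.FactGroup_iso) simp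
  finally show ?thesis .
qed

lemma nat_pow_monoid_vec:
  fixes v :: "int vec" and m :: nat
  assumes "v \<in> carrier_vec n"
  shows "v [^]\<^bsub>monoid_vec TYPE(int) n\<^esub> m = int m \<cdot>\<^sub>v v"
  using assms
  by (induction m) (auto simp: nat_pow_def monoid_vec_simps algebra_simps)

section \<open>The cycle Laplacian in coordinates\<close>

text \<open>Writing the row as \<open>Suc j mod n\<close> names both neighbours without subtraction.
  For \<open>n = 2\<close> they coincide, and the two subtracted terms together account for the
  double edge.\<close>

lemma cycle_laplacian_index:
  fixes d w :: "int vec"
  assumes "n \<ge> 2" "d \<in> carrier_vec n" "w \<in> carrier_vec n"
  shows "(arith_laplacian (cycle_adj_mat n) d *\<^sub>v w) $ (Suc j mod n) =
    d $ (Suc j mod n) * w $ (Suc j mod n) - w $ (j mod n) - w $ (Suc (Suc j) mod n)"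
proof -
  define i where "i = Suc j mod n"
  have i: "i < n" using assms(1) by (simp add: i_def)
  have adj: "cycle_adj_mat n $$ (i, l) = of_bool (l = j mod n) + of_bool (l = Suc (Suc j) mod n)"
    if l: "l < n" for l
  proof (cases "n = 2")
    case True
    have "Suc (Suc j) mod n = j mod n" unfolding True by simp
    moreover have "l = j mod n \<longleftrightarrow> l \<noteq> i"
      using l i unfolding True i_def by (auto simp: mod_Suc split: if_splits)
    ultimately show ?thesis
      using l i unfolding True cycle_adj_mat_2
      by (auto simp: mat_of_rows_list_def less_2_cases_iff)
  next
    case False
    then have n: "n \<ge> 3" using assms(1) by simp
    have 1: "l = Suc i mod n \<longleftrightarrow> l = Suc (Suc j) mod n"
      by (simp add: i_def mod_Suc_eq)
    have 2: "i = Suc l mod n \<longleftrightarrow> l = j mod n"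
      using l n by (auto simp: i_def mod_Suc split: if_splits)
    have 3: "Suc (Suc j) mod n \<noteq> j mod n"
      using n by (auto simp: mod_Suc split: if_splits)
    show ?thesis
      using l i 3 unfolding cycle_adj_mat_ge3[OF n] by (auto simp: 1 2)
  qed
  have dims: "cycle_adj_mat n \<in> carrier_mat n n" by (simp add: cycle_adj_mat_def)
  have entry: "arith_laplacian (cycle_adj_mat n) d $$ (i, l) =
      of_bool (l = i) * d $ l - of_bool (l = j mod n) - of_bool (l = Suc (Suc j) mod n)"
    if "l < n" for l
    using that i assms(2) dims adj[OF that] by (auto simp: arith_laplacian_def mat_diag_def)
  have "(arith_laplacian (cycle_adj_mat n) d *\<^sub>v w) $ i =
      (\<Sum>l<n. arith_laplacian (cycle_adj_mat n) d $$ (i, l) * w $ l)"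
    using i assms dims by (simp add: scalar_prod_def arith_laplacian_def lessThan_atLeast0)
  also have "\<dots> = (\<Sum>l<n. of_bool (l = i) * (d $ l * w $ l)) - (\<Sum>l<n. of_bool (l = j mod n) * w $ l)
      - (\<Sum>l<n. of_bool (l = Suc (Suc j) mod n) * w $ l)"
    by (simp add: entry left_diff_distrib sum_subtractf mult.assoc)
  also have "\<dots> = d $ i * w $ i - w $ (j mod n) - w $ (Suc (Suc j) mod n)"
    using i assms(1) by (simp add: of_bool_def if_distrib[of "\<lambda>x. x * _"] cong: if_cong)
  finally show ?thesis by (simp add: i_def)
qed

lemma cyclic_index_cases:
  assumes "i < (n::nat)"
  obtains j where "j < n" "i = Suc j mod n"
proof (cases i)
  case 0
  then show ?thesis using assms that[of "n - 1"] by simp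
next
  case (Suc j)
  then show ?thesis using assms that[of j] by simp
qed

section \<open>The image of the Laplacian\<close>

text \<open>A discrete Green identity: summation by parts leaves only the Casoratian of
  \<open>X\<close> and \<open>W\<close> at the two ends.\<close>

lemma second_difference_pairing:
  fixes X V W :: "nat \<Rightarrow> int"
  assumes "\<And>j. X j + X (Suc (Suc j)) = D (Suc j) * X (Suc j)"
    and "\<And>j. V (Suc j) = D (Suc j) * W (Suc j) - W j - W (Suc (Suc j))"
  shows "(\<Sum>j<n. X (Suc j) * V (Suc j)) =
    (X 0 * W (Suc 0) - X (Suc 0) * W 0) - (X n * W (Suc n) - X (Suc n) * W n)"
proof -
  define U where "U j = X j * W (Suc j) - X (Suc j) * W j" for j
  have step: "X (Suc j) * V (Suc j) = U j - U (Suc j)" for j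
  proof -
    have X: "X (Suc (Suc j)) = D (Suc j) * X (Suc j) - X j"
      using assms(1)[of j] by simp
    show ?thesis unfolding U_def X assms(2) by (simp add: algebra_simps)
  qed
  have "(\<Sum>j<n. X (Suc j) * V (Suc j)) = U 0 - U n"
    by (simp only: step sum_lessThan_telescope')
  then show ?thesis by (simp only: U_def)
qed

text \<open>Variation of constants: the sums form a particular solution, and the homogeneous term
  \<open>b * S j\<close> leaves a parameter for enforcing periodicity.\<close>

lemma second_difference_solution:
  fixes D R S V W :: "nat \<Rightarrow> int" and b :: int
  assumes "\<And>j. R j + R (Suc (Suc j)) = D (Suc j) * R (Suc j)"
    and "\<And>j. S j + S (Suc (Suc j)) = D (Suc j) * S (Suc j)"
    and "\<And>j. R j * S (Suc j) - R (Suc j) * S j = 1"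
    and W: "\<And>j. W j = b * S j + R j * (\<Sum>i<j. S (Suc i) * V (Suc i))
      - S j * (\<Sum>i<j. R (Suc i) * V (Suc i))"
  shows "V (Suc j) = D (Suc j) * W (Suc j) - W j - W (Suc (Suc j))"
proof -
  define P Q where "P = (\<Sum>i<j. S (Suc i) * V (Suc i))" and "Q = (\<Sum>i<j. R (Suc i) * V (Suc i))"
  have *: "S (Suc (Suc j)) = D (Suc j) * S (Suc j) - S j"
    "R (Suc (Suc j)) = D (Suc j) * R (Suc j) - R j"
    using assms(1,2)[of j] by simp_all
  have "D (Suc j) * W (Suc j) - W j - W (Suc (Suc j)) =
      (R j * S (Suc j) - R (Suc j) * S j) * V (Suc j)"
    unfolding W sum.lessThan_Suc P_def[symmetric] Q_def[symmetric] *
    by (simp add: algebra_simps)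
  then show ?thesis using assms(3) by simp
qed

context cyclic_recurrence
begin

text \<open>The index is shifted by one so that the sum over a period telescopes from \<open>0\<close> to \<open>n\<close>, without
  negative indices.\<close>
definition pairing :: "(nat \<Rightarrow> int) \<Rightarrow> int vec \<Rightarrow> int" where
  "pairing X v = (\<Sum>j<n. X (Suc j) * v $ (Suc j mod n))"

lemma pairing_add:
  assumes "v \<in> carrier_vec n" "w \<in> carrier_vec n"
  shows "pairing X (v + w) = pairing X v + pairing X w"
  using assms n_ge_2 by (simp add: pairing_def distrib_left sum.distrib)

lemma pairing_smult:
  assumes "v \<in> carrier_vec n"
  shows "pairing X (c \<cdot>\<^sub>v v) = c * pairing X v"
  using assms n_ge_2 by (simp add: pairing_def sum_distrib_left mult_ac)

text \<open>Necessity is the Green identity: the boundary terms cancel for \<open>R\<close>, and the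
  shift of \<open>S\<close> leaves a multiple of \<open>ones\<close>. Sufficiency amounts to finding
  a periodic solution.\<close>

lemma image_laplacian_iff:
  assumes d: "d \<in> carrier_vec n" "\<And>j. d $ (j mod n) = D j"
    and S: "\<And>j. S j + S (Suc (Suc j)) = D (Suc j) * S (Suc j)"
      "\<And>j. R j * S (Suc j) - R (Suc j) * S j = 1"
      "\<And>j. S (j + n) = S j + int ones * R j"
    and v: "v \<in> carrier_vec n"
  shows "v \<in> (\<lambda>w. arith_laplacian (cycle_adj_mat n) d *\<^sub>v w) ` carrier_vec n \<longleftrightarrow>
    pairing R v = 0 \<and> int ones dvd pairing S v" (is "?lhs \<longleftrightarrow> ?rhs")
proof
  assume ?lhs
  then obtain w where w: "w \<in> carrier_vec n" "v = arith_laplacian (cycle_adj_mat n) d *\<^sub>v w"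
    by auto
  define W where "W j = w $ (j mod n)" for j
  have V: "v $ (Suc j mod n) = D (Suc j) * W (Suc j) - W j - W (Suc (Suc j))" for j
    using cycle_laplacian_index[OF n_ge_2 d(1) w(1)] d(2) by (simp add: w(2) W_def)
  have W: "W n = W 0" "W (Suc n) = W (Suc 0)"
    by (simp_all add: W_def mod_Suc)
  have "pairing R v = 0"
    using second_difference_pairing[where V = "\<lambda>j. v $ (j mod n)", OF R_rec V, of n]
      W R_periodic[of 0] R_periodic[of 1] by (simp add: pairing_def)
  moreover have "pairing S v = int ones * (R (Suc 0) * W 0 - R 0 * W (Suc 0))"
    using second_difference_pairing[where V = "\<lambda>j. v $ (j mod n)", OF S(1) V, of n]
      W S(3)[of 0] S(3)[of 1] by (simp add: pairing_def algebra_simps)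
  ultimately show ?rhs by simp
next
  assume ?rhs
  then obtain m where "pairing R v = 0" "pairing S v = int ones * m"
    by auto
  define V where "V j = v $ (j mod n)" for j
  \<comment> \<open>With the coefficient \<open>- m\<close>, the growth
    \<open>- m * int ones * R 0\<close> of the homogeneous term over a period cancels the
    contribution \<open>R 0 * (int ones * m)\<close> of the first sum.\<close>
  define W where "W j = - m * S j + R j * (\<Sum>i<j. S (Suc i) * V (Suc i))
      - S j * (\<Sum>i<j. R (Suc i) * V (Suc i))" for j
  have rel: "V (Suc j) = D (Suc j) * W (Suc j) - W j - W (Suc (Suc j))" for j
    by (rule second_difference_solution[OF R_rec S(1,2) W_def])
  have sums: "(\<Sum>i<n. R (Suc i) * V (Suc i)) = 0" "(\<Sum>i<n. S (Suc i) * V (Suc i)) = int ones * m"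
    using \<open>pairing R v = 0\<close> \<open>pairing S v = int ones * m\<close> by (simp_all add: pairing_def V_def)
  have "S n = S 0 + int ones * R 0" "S (Suc n) = S (Suc 0) + int ones * R (Suc 0)"
    "R n = R 0" "R (Suc n) = R (Suc 0)"
    using S(3)[of 0] S(3)[of 1] R_periodic[of 0] R_periodic[of 1] by simp_all
  have Wn: "W n = W 0"
    using \<open>S n = _\<close> \<open>R n = _\<close> unfolding W_def sums by (simp add: algebra_simps)
  \<comment> \<open>The summands with \<open>i = n\<close> in the two sums cancel.\<close>
  have WSn: "W (Suc n) = W (Suc 0)"
  proof -
    have "V (Suc n) = V (Suc 0)" by (simp add: V_def mod_Suc)
    then show ?thesis
      using \<open>S (Suc n) = _\<close> \<open>R (Suc n) = _\<close>
      unfolding W_def sum.lessThan_Suc sums by (simp add: algebra_simps)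
  qed
  \<comment> \<open>The rows \<open>Suc j mod n\<close> with \<open>j < n\<close> involve
    \<open>W\<close> only up to index \<open>Suc n\<close>.\<close>
  have W_mod: "W (j mod n) = W j" if "j \<le> Suc n" for j
    using that Wn WSn n_ge_2 by (cases "j = n \<or> j = Suc n") (auto simp: mod_Suc)
  define w where "w = vec n W"
  have w: "w \<in> carrier_vec n" by (simp add: w_def)
  have w_index: "w $ (j mod n) = W j" if "j \<le> Suc n" for j
    using W_mod[OF that] n_ge_2 by (simp add: w_def)
  have "v = arith_laplacian (cycle_adj_mat n) d *\<^sub>v w"
  proof (rule eq_vecI)
    fix i assume "i < dim_vec (arith_laplacian (cycle_adj_mat n) d *\<^sub>v w)"
    then have "i < n" by (simp add: arith_laplacian_def cycle_adj_mat_def)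
    then obtain j where j: "j < n" "i = Suc j mod n" by (rule cyclic_index_cases)
    show "v $ i = (arith_laplacian (cycle_adj_mat n) d *\<^sub>v w) $ i"
      unfolding j(2) cycle_laplacian_index[OF n_ge_2 d(1) w] d(2)
      using j(1) rel[of j] w_index[of j] by (simp add: w_index V_def)
  qed (use v in \<open>simp add: arith_laplacian_def cycle_adj_mat_def\<close>)
  then show ?lhs using w by blast
qed

section \<open>The critical group\<close>

lemma pairing_solve:
  assumes "\<And>j. R j * S (Suc j) - R (Suc j) * S j = 1"
  obtains v where "v \<in> carrier_vec n" "pairing R v = 0" "pairing S v = c"
proof -
  \<comment> \<open>Supported on positions 1 and 2 (position 0 if \<open>n = 2\<close>), this vector
    pairs with any \<open>X\<close> to \<open>c * (R 1 * X 2 - R 2 * X 1)\<close>, which is 0 for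
    \<open>R\<close> and \<open>c\<close> for \<open>S\<close>.\<close>
  define v where "v = vec n (\<lambda>i. if i = 1 then - c * R 2 else if i = 2 mod n then c * R 1 else 0)"
  have "v $ (Suc j mod n) = of_bool (j = 0) * (- c * R 2) + of_bool (j = 1) * (c * R 1)"
    if "j < n" for j
  proof -
    have "Suc j mod n = 1 \<longleftrightarrow> j = 0" "Suc j mod n = 2 mod n \<longleftrightarrow> j = 1"
      using that n_ge_2 by (auto simp: mod_Suc numeral_2_eq_2)
    then show ?thesis using n_ge_2 by (simp add: v_def)
  qed
  then have "pairing X v = (\<Sum>j<n. of_bool (j = 0) * (- c * R 2 * X 1) + of_bool (j = 1) * (c * R 1 * X 2))" for X
    unfolding pairing_def
    by (intro sum.cong) (auto simp: of_bool_def numeral_2_eq_2)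
  moreover have "(\<Sum>j<n. of_bool (j = i) * x) = x" if "i < n" for i and x :: int
    using that by (simp add: of_bool_def if_distrib[of "\<lambda>y. y * _"] cong: if_cong)
  ultimately have pairing_v: "pairing X v = c * (R 1 * X 2 - R 2 * X 1)" for X
    using n_ge_2 by (simp only: sum.distrib) (simp add: algebra_simps)
  show thesis
    using that[of v] assms[of 1] pairing_v[of R] pairing_v[of S]
    by (simp add: v_def numeral_2_eq_2)
qed

theorem critical_group_iso:
  assumes d: "d \<in> carrier_vec n" "\<And>j. d $ (j mod n) = D j"
  shows "critical_group n (cycle_adj_mat n) d \<cong> integer_mod_group ones"
proof -
  obtain S where S: "\<And>j. S j + S (Suc (Suc j)) = D (Suc j) * S (Suc j)"
      "\<And>j. R j * S (Suc j) - R (Suc j) * S j = 1"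
      "\<And>j. S (j + n) = S j + int ones * R j"
    and "ones > 0"
    by (rule second_solution, rule that)
  define G where "G = monoid_vec TYPE(int) n"
  interpret G: comm_group G unfolding G_def by (rule comm_group_vec)
  have G_simps: "carrier G = carrier_vec n" "monoid.mult G = (+)" "\<one>\<^bsub>G\<^esub> = 0\<^sub>v n"
    by (simp_all add: G_def monoid_vec_simps)
  define I where "I = (\<lambda>w. arith_laplacian (cycle_adj_mat n) d *\<^sub>v w) ` carrier_vec n"
  define T where "T = {v \<in> carrier_vec n. pairing R v = 0}"
  define h where "h v = pairing S v mod int ones" for v
  have I_sub: "I \<subseteq> carrier_vec n"
    unfolding I_def by (auto intro!: carrier_vecI simp: arith_laplacian_def cycle_adj_mat_def)
  have I_iff: "v \<in> I \<longleftrightarrow> pairing R v = 0 \<and> int ones dvd pairing S v" if "v \<in> carrier_vec n" for v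
    unfolding I_def using d S that by (rule image_laplacian_iff)
  have "group_hom G integer_group (pairing R)"
    using G.is_group group_integer_group
    by (auto simp: group_hom_def group_hom_axioms_def hom_def G_simps pairing_add)
  then have "subgroup (kernel G integer_group (pairing R)) G"
    by (rule group_hom.subgroup_kernel)
  then have T: "subgroup T G"
    by (simp add: kernel_def T_def G_simps)
  have "(G Mod I)\<lparr>carrier := torsion_subgroup (G Mod I)\<rparr> \<cong> integer_mod_group ones"
  proof (rule G.torsion_of_quotient_iso[OF T, where h = h])
    show "h \<in> hom (G\<lparr>carrier := T\<rparr>) (integer_mod_group ones)"
      using \<open>ones > 0\<close>
      by (auto simp: hom_def h_def T_def G_simps carrier_integer_mod_group pairing_add mod_add_eq)
    show "h ` T = carrier (integer_mod_group ones)"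
    proof
      show "carrier (integer_mod_group ones) \<subseteq> h ` T"
      proof
        fix c assume "c \<in> carrier (integer_mod_group ones)"
        then have "c mod int ones = c" using \<open>ones > 0\<close> by (simp add: carrier_integer_mod_group)
        moreover obtain v where "v \<in> carrier_vec n" "pairing R v = 0" "pairing S v = c"
          using pairing_solve[OF S(2)] .
        ultimately show "c \<in> h ` T" by (auto simp: h_def T_def intro!: image_eqI[of _ _ v])
      qed
    qed (use \<open>ones > 0\<close> in \<open>auto simp: h_def carrier_integer_mod_group\<close>)
    show "I = kernel (G\<lparr>carrier := T\<rparr>) (integer_mod_group ones) h"
      using I_sub I_iff by (auto simp: kernel_def T_def h_def dvd_eq_mod_eq_0)
  next
    fix a assume "a \<in> carrier G"
    then have a: "a \<in> carrier_vec n" by (simp add: G_simps)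
    have "a [^]\<^bsub>G\<^esub> m \<in> I \<longleftrightarrow> int m * pairing R a = 0 \<and> int ones dvd int m * pairing S a" for m :: nat
      using a I_iff[of "int m \<cdot>\<^sub>v a"] by (simp add: G_def nat_pow_monoid_vec pairing_smult)
    \<comment> \<open>A positive \<open>m\<close> cancels in the first condition; conversely,
      \<open>m = ones\<close> satisfies the second.\<close>
    then show "(\<exists>m::nat>0. a [^]\<^bsub>G\<^esub> m \<in> I) \<longleftrightarrow> a \<in> T"
      using a \<open>ones > 0\<close> by (auto simp: T_def)
  qed simp
  then show ?thesis
    by (simp add: critical_group_def mat_cokernel_def G_def I_def)
qed

end

section \<open>From arithmetical structures to recurrences\<close>

text \<open>The recurrence preserves the gcd of consecutive entries; it therefore divides every
  entry, and primitivity makes it 1.\<close>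

lemma cyclic_recurrence_of_arithmetical_structure:
  assumes n: "n \<ge> 2" and "arithmetical_structure n (cycle_adj_mat n) d r"
  shows "cyclic_recurrence n (\<lambda>j. d $ (j mod n)) (\<lambda>j. r $ (j mod n))"
proof -
  define D R where "D j = d $ (j mod n)" and "R j = r $ (j mod n)" for j
  have carrier: "d \<in> carrier_vec n" "r \<in> carrier_vec n"
    and pos: "\<And>i. i < n \<Longrightarrow> r $ i > 0"
    and gcd1: "(GCD i\<in>{..<n}. r $ i) = 1"
    and null: "arith_laplacian (cycle_adj_mat n) d *\<^sub>v r = 0\<^sub>v n"
    using assms(2) by (auto simp: arithmetical_structure_def)
  have rec: "R j + R (Suc (Suc j)) = D (Suc j) * R (Suc j)" for j
    using cycle_laplacian_index[OF n carrier, of j] n by (simp add: null D_def R_def)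
  have "gcd (R j) (R (Suc j)) = gcd (R 0) (R (Suc 0))" for j
  proof (induction j)
    case (Suc j)
    have "R (Suc (Suc j)) = D (Suc j) * R (Suc j) + - R j" using rec[of j] by simp
    then have "gcd (R (Suc j)) (R (Suc (Suc j))) = gcd (R j) (R (Suc j))"
      by (simp only: gcd_add_mult gcd_neg1 gcd_neg2 gcd.commute)
    then show ?case using Suc by simp
  qed simp
  then have gcd_const: "gcd (R j) (R (Suc j)) = gcd (R 0) (R (Suc 0))" for j .
  have "gcd (R 0) (R (Suc 0)) dvd (GCD i\<in>{..<n}. r $ i)"
  proof (rule Gcd_greatest)
    fix x assume "x \<in> (\<lambda>i. r $ i) ` {..<n}"
    then obtain i where "i < n" "x = r $ i" by auto
    then have "x = R i" by (simp add: R_def)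
    then show "gcd (R 0) (R (Suc 0)) dvd x" using gcd_const[of i] by (metis gcd_dvd1)
  qed
  then have "gcd (R 0) (R (Suc 0)) = 1" by (simp add: gcd1)
  then have "coprime (R j) (R (Suc j))" for j
    using gcd_const by (simp add: coprime_iff_gcd_eq_1)
  then show ?thesis
    using n pos rec by unfold_locales (auto simp: D_def R_def)
qed

theorem theorem3p6:
  fixes n :: nat and d r :: "int vec"
  assumes "n \<ge> 2"
    and "arithmetical_structure n (cycle_adj_mat n) d r"
  shows "int (num_ones r) = 3 * int n - (\<Sum>j<n. d $ j) \<and>
    critical_group n (cycle_adj_mat n) d \<cong> integer_mod_group (num_ones r)"
proof -
  interpret cyclic_recurrence n "\<lambda>j. d $ (j mod n)" "\<lambda>j. r $ (j mod n)"
    using assms by (rule cyclic_recurrence_of_arithmetical_structure)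
  have carrier: "d \<in> carrier_vec n" "r \<in> carrier_vec n"
    using assms(2) by (auto simp: arithmetical_structure_def)
  have "num_ones r = ones"
    using carrier unfolding num_ones_def ones_def by (intro arg_cong[of _ _ card]) auto
  then show ?thesis
    using ones_eq critical_group_iso[OF carrier(1)] by simp
qed

end
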